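(* Let $M\in\mathbb{N}$ and let $\alpha$ be an exact $k$-typed parking function of order $(m_1,\ldots,m_k)$, where $m_1+\cdots+m_k=M$. Then $\mathrm{fam}(\alpha)$ maps to exactly one parking configuration: there is a parking configuration $C$ of order $(m_1,\ldots,m_k)$ such that every element of $\mathrm{fam}(\alpha)$ results in $C$ and no element of $\mathrm{fam}(\alpha)$ results in any configuration other than $C$.
   Context: $m_1,\ldots,m_k$ are positive integers with $m_1+\cdots+m_k=M$. There are $M$ cars, $m_i$ of them of type $i$, and $M$ parking spots in a row. Consider tuples $\alpha=(m_1;P_2,\ldots,P_k)$, where each $P_i=(p^{(i)}_1,\ldots,p^{(i)}_{m_i})$ is an ordered list of nonnegative integers (for $k=1$, $\alpha=(m_1)$). Such an $\alpha$ is an exact $k$-typed parking function (exact $k$-TPF) of order $(m_1,\ldots,m_k)$ if there is an arrangement of the $M$ cars in the $M$ spots, one car per spot, such that for all $2\le i\le k$ and $1\le j\le m_i$ the $j$-th car of type $i$ has exactly $p^{(i)}_j$ cars of types in $\{1,\ldots,i-1\}$ parked before it. A parking configuration of order $(m_1,\ldots,m_k)$ is a word $C$ of length $M$ in the letters $1,\ldots,k$ in which each letter $i$ occurs exactly $m_i$ times; $\alpha$ results in $C$ if $C$ is the word of types of the cars, read from spot $1$ to spot $M$, in such an arrangement. An exact $k$-TPF $\beta=(m_1;Q_2,\ldots,Q_k)$ is a parking permutation of $\alpha=(m_1;P_2,\ldots,P_k)$ if for every $i=2,\ldots,k$ the list $Q_i$ is a rearrangement of the list $P_i$. $\mathrm{fam}(\alpha)$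 is the set of all parking permutations of $\alpha$ (including $\alpha$ itself). *)

theory Defs
  imports "HOL-Library.Multiset"
begin

(* The order (m_1, ..., m_k) is a list ms, with m_i = ms ! (i - 1), and the tuple
   (m_1; P_2, ..., P_k) is the pair (m_1, [P_2, ..., P_k]).  Types, cars of a given type and
   spots are numbered from 1, as in the informal definitions; list positions start at 0. *)

type_synonym typed_prefs = "nat \<times> nat list list"

definition pref_list :: "typed_prefs \<Rightarrow> nat \<Rightarrow> nat list" where
  "pref_list \<alpha> i = snd \<alpha> ! (i - 2)"

definition prefs_of_order :: "nat list \<Rightarrow> typed_prefs \<Rightarrow> bool" where
  "prefs_of_order ms \<alpha> \<longleftrightarrow>
     fst \<alpha> = ms ! 0 \<and> length (snd \<alpha>) = length ms - 1 \<and>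
     (\<forall>i\<in>{2..length ms}. length (pref_list \<alpha> i) = ms ! (i - 1))"

(* (i, j) is the j-th car of type i *)
definition cars :: "nat list \<Rightarrow> (nat \<times> nat) set" where
  "cars ms = (SIGMA i:{1..length ms}. {1..ms ! (i - 1)})"

definition arrangement :: "nat list \<Rightarrow> (nat \<times> nat \<Rightarrow> nat) \<Rightarrow> bool" where
  "arrangement ms s \<longleftrightarrow> bij_betw s (cars ms) {1..sum_list ms}"

definition realizes :: "nat list \<Rightarrow> (nat \<times> nat \<Rightarrow> nat) \<Rightarrow> typed_prefs \<Rightarrow> bool" where
  "realizes ms s \<alpha> \<longleftrightarrow>
     arrangement ms s \<and>
     (\<forall>i\<in>{2..length ms}. \<forall>j\<in>{1..ms ! (i - 1)}.
        card {c \<in> cars ms. fst c < i \<and> s c < s (i, j)} = pref_list \<alpha> i ! (j - 1))"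

definition exact_tpf :: "nat list \<Rightarrow> typed_prefs \<Rightarrow> bool" where
  "exact_tpf ms \<alpha> \<longleftrightarrow> prefs_of_order ms \<alpha> \<and> (\<exists>s. realizes ms s \<alpha>)"

definition parking_configuration :: "nat list \<Rightarrow> nat list \<Rightarrow> bool" where
  "parking_configuration ms C \<longleftrightarrow>
     length C = sum_list ms \<and> set C \<subseteq> {1..length ms} \<and>
     (\<forall>i\<in>{1..length ms}. count_list C i = ms ! (i - 1))"

definition type_word :: "nat list \<Rightarrow> (nat \<times> nat \<Rightarrow> nat) \<Rightarrow> nat list" where
  "type_word ms s = map (\<lambda>x. fst (inv_into (cars ms) s x)) [1..<Suc (sum_list ms)]"

definition results_in :: "nat list \<Rightarrow> typed_prefs \<Rightarrow> nat list \<Rightarrow> bool" where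
  "results_in ms \<alpha> C \<longleftrightarrow> (\<exists>s. realizes ms s \<alpha> \<and> C = type_word ms s)"

definition parking_permutation :: "nat list \<Rightarrow> typed_prefs \<Rightarrow> typed_prefs \<Rightarrow> bool" where
  "parking_permutation ms \<alpha> \<beta> \<longleftrightarrow>
     exact_tpf ms \<beta> \<and> (\<forall>i\<in>{2..length ms}. mset (pref_list \<beta> i) = mset (pref_list \<alpha> i))"

definition fam :: "nat list \<Rightarrow> typed_prefs \<Rightarrow> typed_prefs set" where
  "fam ms \<alpha> = {\<beta>. parking_permutation ms \<alpha> \<beta>}"

end

theory Submission
  imports Defs
begin

text \<open>
  A typing of the spots is determined by the following data: for every type \<open>i\<close>, the multiset of
  the numbers of smaller-typed spots to the left of the spots of type \<open>i\<close>.  Indeed, let \<open>p\<close> be the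
  first spot where two typings \<open>T\<close> and \<open>T'\<close> differ, say \<open>T p < T' p = b\<close>, and let \<open>c\<close> be the number
  of spots before \<open>p\<close> with type below \<open>b\<close>.  In \<open>T\<close>, spot \<open>p\<close> itself has type below \<open>b\<close>, so beyond
  \<open>p\<close> every spot of type \<open>b\<close> has more than \<open>c\<close> smaller-typed spots on its left; hence all entries at
  most \<open>c\<close> of the multiset of \<open>T\<close> for \<open>b\<close> come from spots before \<open>p\<close>.  In \<open>T'\<close> the same spots
  contribute such entries, and \<open>p\<close> contributes one more.  So the multisets for \<open>b\<close> differ
  (\<open>first_difference_changes_smaller_before\<close>).

  If an arrangement realizes \<open>\<beta>\<close>, then the multiset of its typing for a type \<open>i \<ge> 2\<close> is the multiset
  of the entries of the preference list of type \<open>i\<close> (\<open>realizes_smaller_before\<close>).  Parking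
  permutations leave these multisets unchanged, so all arrangements realizing members of the family
  have the same word of types.  Type 1, which has no preferences, causes no ambiguity: the larger of
  two different types is at least 2.
\<close>

section \<open>Typings determined by counts of smaller entries\<close>

definition smaller_before :: "'a::linorder set \<Rightarrow> ('a \<Rightarrow> 'b::linorder) \<Rightarrow> 'b \<Rightarrow> 'a \<Rightarrow> nat" where
  "smaller_before A T i x = card {y \<in> A. T y < i \<and> y < x}"

lemma smaller_before_mono:
  "finite A \<Longrightarrow> x \<le> y \<Longrightarrow> smaller_before A T i x \<le> smaller_before A T i y"
  unfolding smaller_before_def by (rule card_mono) auto

lemma smaller_before_strict_mono:
  assumes "finite A" "p \<in> A" "T p < i" "p < x"
  shows "smaller_before A T i p < smaller_before A T i x"
  unfolding smaller_before_def using assms by (intro psubset_card_mono) auto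

lemma smaller_before_cong:
  assumes "\<And>y. y \<in> A \<Longrightarrow> y < p \<Longrightarrow> T y = T' y" "x \<le> p"
  shows "smaller_before A T i x = smaller_before A T' i x"
  unfolding smaller_before_def using assms by (intro arg_cong[where f = card]) force

lemma size_filter_image_mset_set:
  assumes "finite A"
  shows "size (filter_mset P (image_mset f (mset_set {x \<in> A. Q x}))) = card {x \<in> A. Q x \<and> P (f x)}"
  using assms by (simp add: filter_mset_image_mset filter_mset_mset_set conj_assoc)

text \<open>
  The two multisets are told apart by the number of their entries that do not exceed the value of
  \<open>smaller_before\<close> at \<open>p\<close>.
\<close>

lemma first_difference_changes_smaller_before:
  fixes T T' :: "'a::linorder \<Rightarrow> 'b::linorder"
  assumes "finite A" "p \<in> A"
    and agree: "\<And>q. q \<in> A \<Longrightarrow> q < p \<Longrightarrow> T q = T' q"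
    and less: "T p < T' p"
  defines "b \<equiv> T' p"
  shows "image_mset (smaller_before A T b) (mset_set {x \<in> A. T x = b}) \<noteq>
         image_mset (smaller_before A T' b) (mset_set {x \<in> A. T' x = b})" (is "?N \<noteq> ?N'")
proof
  assume eq: "?N = ?N'"
  define c where "c = smaller_before A T b p"
  have c': "c = smaller_before A T' b p"
    unfolding c_def by (rule smaller_before_cong[OF agree]) auto
  have sub: "{x \<in> A. T x = b \<and> smaller_before A T b x \<le> c} \<subseteq> {x \<in> A. T x = b \<and> x < p}"
  proof safe
    fix x assume x: "x \<in> A" "b = T x" "smaller_before A T (T x) x \<le> c"
    have "x \<noteq> p" using less x by (auto simp: b_def)
    moreover have "\<not> p < x"
      using smaller_before_strict_mono[OF assms(1,2), of T b x] less x
      by (auto simp: b_def c_def)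
    ultimately show "x < p" by auto
  qed
  have psub: "{x \<in> A. T x = b \<and> x < p} \<subset> {x \<in> A. T' x = b \<and> smaller_before A T' b x \<le> c}"
  proof (rule psubsetI)
    show "{x \<in> A. T x = b \<and> x < p} \<subseteq> {x \<in> A. T' x = b \<and> smaller_before A T' b x \<le> c}"
      using agree smaller_before_mono[OF assms(1), of _ p T' b] c' by auto
    have "p \<in> {x \<in> A. T' x = b \<and> smaller_before A T' b x \<le> c}"
      using assms(2) c' by (auto simp: b_def)
    then show "{x \<in> A. T x = b \<and> x < p} \<noteq> {x \<in> A. T' x = b \<and> smaller_before A T' b x \<le> c}"
      by blast
  qed
  have "card {x \<in> A. T x = b \<and> smaller_before A T b x \<le> c}
      < card {x \<in> A. T' x = b \<and> smaller_before A T' b x \<le> c}"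
    using assms(1) sub psub by (intro psubset_card_mono) auto
  moreover have "card {x \<in> A. T x = b \<and> smaller_before A T b x \<le> c}
      = card {x \<in> A. T' x = b \<and> smaller_before A T' b x \<le> c}"
    using arg_cong[OF eq, of "\<lambda>N. size (filter_mset (\<lambda>n. n \<le> c) N)"]
    by (simp only: size_filter_image_mset_set[OF assms(1)])
  ultimately show False by simp
qed

text \<open>
  The least value \<open>l\<close> is exempt from the hypothesis on multisets because the value that tells two
  typings apart is the larger one of two different values.
\<close>

lemma typing_determined_by_smaller_before:
  fixes T T' :: "'a::linorder \<Rightarrow> 'b::linorder"
  assumes "finite A"
    and T: "T ` A \<subseteq> {l..u}" and T': "T' ` A \<subseteq> {l..u}"
    and eq: "\<And>i. l < i \<Longrightarrow> i \<le> u \<Longrightarrow>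
      image_mset (smaller_before A T i) (mset_set {x \<in> A. T x = i}) =
      image_mset (smaller_before A T' i) (mset_set {x \<in> A. T' x = i})"
    and "x \<in> A"
  shows "T x = T' x"
proof (rule ccontr)
  assume "T x \<noteq> T' x"
  define D where "D = {y \<in> A. T y \<noteq> T' y}"
  define p where "p = Min D"
  have D: "finite D" "D \<noteq> {}" using assms(1,5) \<open>T x \<noteq> T' x\<close> by (auto simp: D_def)
  have p: "p \<in> A" "T p \<noteq> T' p" using Min_in[OF D] by (auto simp: p_def D_def)
  have agree: "T q = T' q" if "q \<in> A" "q < p" for q
    using Min_le[OF D(1), of q] that by (force simp: p_def D_def)
  have bounds: "l \<le> T p" "T p \<le> u" "l \<le> T' p" "T' p \<le> u"
    using T T' p(1) by (auto simp: image_subset_iff)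
  from p(2) consider "T p < T' p" | "T' p < T p" by force
  then show False
  proof cases
    case 1
    then have "l < T' p" using bounds by simp
    then show False
      using first_difference_changes_smaller_before[OF assms(1) p(1), of T T'] agree 1 eq bounds
      by simp
  next
    case 2
    then have "l < T p" using bounds by simp
    then show False
      using first_difference_changes_smaller_before[OF assms(1) p(1), of T' T] agree 2 eq bounds
      by simp
  qed
qed

section \<open>The typing of an arrangement\<close>

definition type_at :: "nat list \<Rightarrow> (nat \<times> nat \<Rightarrow> nat) \<Rightarrow> nat \<Rightarrow> nat" where
  "type_at ms s x = fst (inv_into (cars ms) s x)"

lemma type_word_eq_map: "type_word ms s = map (type_at ms s) [1..<Suc (sum_list ms)]"
  by (simp add: type_word_def type_at_def)

lemma type_at_car:
  assumes "arrangement ms s" "c \<in> cars ms"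
  shows "type_at ms s (s c) = fst c"
  using assms by (simp add: arrangement_def type_at_def bij_betw_def)

lemma spot_of_car:
  assumes "arrangement ms s" "c \<in> cars ms"
  shows "s c \<in> {1..sum_list ms}"
  using bij_betwE[OF assms(1)[unfolded arrangement_def]] assms(2) by blast

lemma car_at_spot:
  assumes "arrangement ms s" "x \<in> {1..sum_list ms}"
  obtains c where "c \<in> cars ms" "x = s c"
  using assms unfolding arrangement_def bij_betw_def by blast

lemma spots_of_types:
  assumes "arrangement ms s"
  shows "{x \<in> {1..sum_list ms}. P (type_at ms s x) x} = s ` {c \<in> cars ms. P (fst c) (s c)}"
proof (intro subset_antisym subsetI)
  fix x assume x: "x \<in> {x \<in> {1..sum_list ms}. P (type_at ms s x) x}"
  then obtain c where "c \<in> cars ms" "x = s c" using car_at_spot[OF assms] by blast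
  then show "x \<in> s ` {c \<in> cars ms. P (fst c) (s c)}" using x type_at_car[OF assms] by auto
next
  fix x assume "x \<in> s ` {c \<in> cars ms. P (fst c) (s c)}"
  then show "x \<in> {x \<in> {1..sum_list ms}. P (type_at ms s x) x}"
    using spot_of_car[OF assms] type_at_car[OF assms] by force
qed

lemma inj_on_cars: "arrangement ms s \<Longrightarrow> B \<subseteq> cars ms \<Longrightarrow> inj_on s B"
  unfolding arrangement_def bij_betw_def by (blast intro: inj_on_subset)

lemma card_spots_of_types:
  assumes "arrangement ms s"
  shows "card {x \<in> {1..sum_list ms}. P (type_at ms s x) x} = card {c \<in> cars ms. P (fst c) (s c)}"
  unfolding spots_of_types[OF assms] by (rule card_image) (auto intro: inj_on_cars[OF assms])

lemma cars_of_type: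
  assumes "i \<in> {1..length ms}"
  shows "{c \<in> cars ms. fst c = i} = Pair i ` {1..ms ! (i - 1)}"
  using assms by (auto simp: cars_def)

lemma type_at_range:
  assumes "arrangement ms s"
  shows "type_at ms s ` {1..sum_list ms} \<subseteq> {1..length ms}"
proof safe
  fix x assume "x \<in> {1..sum_list ms}"
  then obtain c where "c \<in> cars ms" "x = s c" using car_at_spot[OF assms] by blast
  then show "type_at ms s x \<in> {1..length ms}"
    using type_at_car[OF assms] by (auto simp: cars_def)
qed

lemma type_word_configuration:
  assumes "arrangement ms s"
  shows "parking_configuration ms (type_word ms s)"
  unfolding parking_configuration_def
proof (intro conjI ballI)
  show "length (type_word ms s) = sum_list ms"
    by (simp add: type_word_eq_map del: upt_Suc)
  show "set (type_word ms s) \<subseteq> {1..length ms}"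
    using type_at_range[OF assms] by (simp add: type_word_eq_map atLeastLessThanSuc_atLeastAtMost
        del: upt_Suc)
next
  fix i assume i: "i \<in> {1..length ms}"
  have "count_list (type_word ms s) i
      = card {x \<in> {1..sum_list ms}. type_at ms s x = i}"
  proof -
    have "count_list (type_word ms s) i
        = length (filter (\<lambda>x. i = type_at ms s x) [1..<Suc (sum_list ms)])"
      unfolding type_word_eq_map count_list_eq_length_filter filter_map length_map o_def ..
    also have "\<dots> = card ({x. i = type_at ms s x} \<inter> {1..sum_list ms})"
      by (simp only: distinct_length_filter distinct_upt set_upt atLeastLessThanSuc_atLeastAtMost)
    also have "{x. i = type_at ms s x} \<inter> {1..sum_list ms} = {x \<in> {1..sum_list ms}. type_at ms s x = i}"
      by blast
    finally show ?thesis .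
  qed
  also have "\<dots> = card {c \<in> cars ms. fst c = i}"
    by (rule card_spots_of_types[OF assms])
  also have "\<dots> = ms ! (i - 1)"
    unfolding cars_of_type[OF i] by (simp add: card_image inj_on_def)
  finally show "count_list (type_word ms s) i = ms ! (i - 1)" .
qed

section \<open>Preferences as counts of smaller types\<close>

lemma mset_eq_image_nth_pred: "mset xs = image_mset (\<lambda>j. xs ! (j - 1)) (mset_set {1..length xs})"
proof -
  have "xs = map (\<lambda>j. xs ! (j - 1)) [1..<Suc (length xs)]"
    by (rule nth_equalityI) (simp_all del: upt_Suc)
  then have "mset xs = mset (map (\<lambda>j. xs ! (j - 1)) [1..<Suc (length xs)])" by simp
  also have "\<dots> = image_mset (\<lambda>j. xs ! (j - 1)) (mset_set {1..length xs})"
    by (simp only: mset_map mset_upt atLeastLessThanSuc_atLeastAtMost)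
  finally show ?thesis .
qed

text \<open>
  A preference is a count of cars; transported along the bijection between cars and spots it becomes
  a count of spots, which refers to the arrangement only through its typing.
\<close>

lemma realizes_smaller_before:
  assumes "realizes ms s \<beta>" "prefs_of_order ms \<beta>" and i: "i \<in> {2..length ms}"
  defines "A \<equiv> {1..sum_list ms}" and "T \<equiv> type_at ms s"
  shows "image_mset (smaller_before A T i) (mset_set {x \<in> A. T x = i}) = mset (pref_list \<beta> i)"
proof -
  have arr: "arrangement ms s" using assms(1) by (simp add: realizes_def)
  let ?J = "{1..ms ! (i - 1)}"
  have i1: "i \<in> {1..length ms}" using i by simp
  have fiber: "{x \<in> A. T x = i} = (\<lambda>j. s (i, j)) ` ?J"
    using spots_of_types[OF arr, of "\<lambda>t x. t = i"] cars_of_type[OF i1]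
    by (simp add: A_def T_def image_image)
  have car: "(i, j) \<in> cars ms" if "j \<in> ?J" for j
    using that i1 by (simp add: cars_def)
  have inj: "inj_on (\<lambda>j. s (i, j)) ?J"
  proof (rule inj_onI)
    fix j j' assume "j \<in> ?J" "j' \<in> ?J" "s (i, j) = s (i, j')"
    then show "j = j'"
      using inj_onD[OF inj_on_cars[OF arr subset_refl], of "(i, j)" "(i, j')"] car by simp
  qed
  have val: "smaller_before A T i (s (i, j)) = pref_list \<beta> i ! (j - 1)" if "j \<in> ?J" for j
  proof -
    have "smaller_before A T i (s (i, j)) = card {c \<in> cars ms. fst c < i \<and> s c < s (i, j)}"
      unfolding smaller_before_def A_def T_def
      by (rule card_spots_of_types[OF arr, of "\<lambda>t x. t < i \<and> x < s (i, j)"])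
    also have "\<dots> = pref_list \<beta> i ! (j - 1)"
      using assms(1) i that by (simp add: realizes_def)
    finally show ?thesis .
  qed
  have len: "length (pref_list \<beta> i) = ms ! (i - 1)"
    using assms(2) i by (simp add: prefs_of_order_def)
  have "image_mset (smaller_before A T i) (mset_set {x \<in> A. T x = i})
      = image_mset (\<lambda>j. smaller_before A T i (s (i, j))) (mset_set ?J)"
    unfolding fiber image_mset_mset_set[OF inj, symmetric] by (simp add: multiset.map_comp o_def)
  also have "\<dots> = image_mset (\<lambda>j. pref_list \<beta> i ! (j - 1)) (mset_set ?J)"
    by (rule image_mset_cong) (simp add: val)
  also have "\<dots> = mset (pref_list \<beta> i)"
    using mset_eq_image_nth_pred[of "pref_list \<beta> i"] by (simp add: len)
  finally show ?thesis .
qed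

lemma type_word_determined_by_preference_msets:
  assumes "realizes ms s \<beta>" "prefs_of_order ms \<beta>"
    and "realizes ms s' \<beta>'" "prefs_of_order ms \<beta>'"
    and eq: "\<And>i. i \<in> {2..length ms} \<Longrightarrow> mset (pref_list \<beta> i) = mset (pref_list \<beta>' i)"
  shows "type_word ms s = type_word ms s'"
proof -
  have arr: "arrangement ms s" "arrangement ms s'"
    using assms(1,3) by (simp_all add: realizes_def)
  have "type_at ms s x = type_at ms s' x" if "x \<in> {1..sum_list ms}" for x
  proof (rule typing_determined_by_smaller_before[OF _ type_at_range[OF arr(1)]
        type_at_range[OF arr(2)] _ that])
    fix i assume "1 < i" "i \<le> length ms"
    then have i: "i \<in> {2..length ms}" by simp
    show "image_mset (smaller_before {1..sum_list ms} (type_at ms s) i)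
            (mset_set {x \<in> {1..sum_list ms}. type_at ms s x = i}) =
          image_mset (smaller_before {1..sum_list ms} (type_at ms s') i)
            (mset_set {x \<in> {1..sum_list ms}. type_at ms s' x = i})"
      using realizes_smaller_before[OF assms(1,2) i] realizes_smaller_before[OF assms(3,4) i] eq[OF i]
      by simp
  qed simp
  then show ?thesis by (simp add: type_word_eq_map del: upt_Suc)
qed

theorem corollary4p5:
  fixes M :: nat and ms :: "nat list" and \<alpha> :: typed_prefs
  assumes "ms \<noteq> []"
    and "\<forall>m\<in>set ms. 0 < m"
    and "sum_list ms = M"
    and "exact_tpf ms \<alpha>"
  shows "\<exists>C. parking_configuration ms C \<and>
           (\<forall>\<beta>\<in>fam ms \<alpha>. results_in ms \<beta> C) \<and>
           (\<forall>\<beta>\<in>fam ms \<alpha>. \<forall>D. parking_configuration ms D \<and> D \<noteq> C \<longrightarrow> \<not> results_in ms \<beta> D)"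
proof -
  obtain s where s: "realizes ms s \<alpha>" and \<alpha>: "prefs_of_order ms \<alpha>"
    using assms(4) by (auto simp: exact_tpf_def)
  have unique: "type_word ms s' = type_word ms s" if "\<beta> \<in> fam ms \<alpha>" "realizes ms s' \<beta>" for \<beta> s'
    using that s \<alpha>
    by (intro type_word_determined_by_preference_msets[of ms s' \<beta> s \<alpha>])
       (auto simp: fam_def parking_permutation_def exact_tpf_def)
  show ?thesis
  proof (intro exI conjI ballI allI impI)
    show "parking_configuration ms (type_word ms s)"
      using s by (simp add: realizes_def type_word_configuration)
  next
    fix \<beta> assume \<beta>: "\<beta> \<in> fam ms \<alpha>"
    then obtain s' where "realizes ms s' \<beta>"
      by (auto simp: fam_def parking_permutation_def exact_tpf_def)
    with unique[OF \<beta>] show "results_in ms \<beta> (type_word ms s)"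
      by (metis results_in_def)
  next
    fix \<beta> D assume "\<beta> \<in> fam ms \<alpha>" "parking_configuration ms D \<and> D \<noteq> type_word ms s"
    then show "\<not> results_in ms \<beta> D"
      using unique by (auto simp: results_in_def)
  qed
qed

end
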